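(* Let $\mathcal{S}=(a_{n,m})_{n,m\geq 0}$ be the infinite matrix of complex numbers determined by an initial row $(a_{0,m})_{m\geq0}$ via $a_{n+1,m}=a_{n,m+1}+m\,a_{n,m}$ for all $n,m\geq 0$. Fix $r\geq 0$ and let $A_r(z)=\sum_{k\geq 0}a_{0,k+r}\frac{z^k}{k!}$ and $B_r(z)=\sum_{n\geq 0}a_{n,r}\frac{z^n}{n!}$ (formal power series). Then $$B_r(z)=e^{rz}A_r\left(e^{z}-1\right).$$ *)

theory Defs
  imports Complex_Main "HOL-Computational_Algebra.Formal_Power_Series"
begin

end

theory Submission
  imports Defs
begin

text \<open>
  The series $F_m = e^{mz} A_m(e^z - 1)$ satisfy $F_m' = F_{m+1} + m F_m$, because
  $A_m' = A_{m+1}$. Hence the numbers $n!\,[z^n] F_m$ obey the recurrence of the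
  matrix and have the same initial row.
\<close>

lemma fps_deriv_egf_shift:
  fixes c :: "nat \<Rightarrow> 'a :: field_char_0"
  shows "fps_deriv (Abs_fps (\<lambda>k. c (k + m) / fact k)) = Abs_fps (\<lambda>k. c (k + Suc m) / fact k)"
  by (rule fps_ext) (simp add: field_simps del: of_nat_Suc)

text \<open>Product and chain rule: the inner derivative is \<open>fps_exp 1\<close>, which the
  prefactor absorbs, raising its exponent from \<open>m\<close> to \<open>Suc m\<close>;
  differentiating the prefactor itself gives the second summand.\<close>

lemma fps_deriv_exp_mult_compose_exp:
  fixes f :: "'a :: field_char_0 fps"
  shows "fps_deriv (fps_exp (of_nat m) * (f oo (fps_exp 1 - 1))) =
    fps_exp (of_nat (Suc m)) * (fps_deriv f oo (fps_exp 1 - 1)) +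
    of_nat m * (fps_exp (of_nat m) * (f oo (fps_exp 1 - 1)))"
proof -
  have "fps_exp (of_nat (Suc m)) = fps_exp (of_nat m) * fps_exp (1 :: 'a)"
    by (simp add: fps_exp_add_mult[symmetric] add.commute)
  then show ?thesis
    by (simp add: fps_compose_deriv fps_of_nat algebra_simps del: of_nat_Suc)
qed

theorem theorem3:
  fixes a :: "nat \<Rightarrow> nat \<Rightarrow> complex" and r :: nat and A B :: "complex fps"
  assumes rec: "\<And>n m. a (Suc n) m = a n (Suc m) + of_nat m * a n m"
    and A: "A = Abs_fps (\<lambda>k. a 0 (k + r) / fact k)"
    and B: "B = Abs_fps (\<lambda>n. a n r / fact n)"
  shows "B = fps_exp (of_nat r) * (A oo (fps_exp 1 - 1))"
proof -
  define F where "F m = fps_exp (of_nat m) *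
    (Abs_fps (\<lambda>k. a 0 (k + m) / fact k) oo (fps_exp 1 - 1))" for m
  have deriv: "fps_deriv (F m) = F (Suc m) + of_nat m * F m" for m
    unfolding F_def fps_deriv_exp_mult_compose_exp fps_deriv_egf_shift ..
  \<comment> \<open>The column \<open>m\<close> stays arbitrary because row \<open>Suc n\<close> at
    \<open>m\<close> draws on row \<open>n\<close> at both \<open>m\<close> and
    \<open>Suc m\<close>.\<close>
  have coeff: "a n m = fact n * fps_nth (F m) n" for n m
  proof (induction n arbitrary: m)
    case 0
    show ?case by (simp add: F_def)
  next
    case (Suc n)
    \<comment> \<open>The factor \<open>Suc n\<close> produced by differentiation turns
      \<open>fact n\<close> into \<open>fact (Suc n)\<close>.\<close>
    have "fact (Suc n) * fps_nth (F m) (Suc n) = fact n * fps_nth (fps_deriv (F m)) n"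
      by (simp add: algebra_simps)
    also have "\<dots> = fact n * fps_nth (F (Suc m)) n + of_nat m * (fact n * fps_nth (F m) n)"
      \<comment> \<open>Read as a constant series, \<open>of_nat m\<close> scales each
        coefficient.\<close>
      unfolding deriv by (simp add: fps_of_nat[symmetric] algebra_simps)
    finally show ?case by (simp only: rec Suc.IH)
  qed
  have "B = F r"
    by (rule fps_ext) (simp add: B coeff)
  then show ?thesis by (simp only: F_def A)
qed

end
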